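(* Let $A$ and $X$ be linear orders. Then $AX\cong X$ if and only if $X$ is isomorphic to an order of the form $A^{\omega}(I_{[u]})$, i.e. to a replacement $A^{\omega}(I_u)$ where $(I_u)_{u\in A^\omega}$ is a family of linear orders (possibly empty) such that $I_u=I_v$ whenever $u\sim v$.
   Context: $AX$ is the lexicographic product $A\times X$. $A^\omega$ is the set of infinite sequences of elements of $A$ ordered lexicographically. Tail-equivalence: $u\sim v$ in $A^\omega$ iff there exist finite sequences $r,s$ (of any lengths) and $u'\in A^\omega$ with $u=ru'$, $v=su'$ (concatenation). Replacement: for a linear order $Y$ and orders $I_y$ ($y\in Y$, possibly empty), $Y(I_y)$ is the set $\{(y,i): y\in Y, i\in I_y\}$ ordered lexicographically (each point $y$ is replaced by a copy of $I_y$). *)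

theory Defs
  imports Main "HOL-Library.Stream"
begin

text \<open>
  A linear order is a reflexive relation \<^term>\<open>r\<close> with \<^term>\<open>Linear_order r\<close>; its underlying set
  is \<^term>\<open>Field r\<close>, so the empty order is included.
\<close>

text \<open>
  The predicate \<^const>\<open>iso\<close> is stated in the library via initial segments, but for arbitrary
  relations it says exactly that \<open>f\<close> is a bijection between the fields preserving and reflecting
  the relations (fact \<open>iso_iff2\<close>); well-foundedness plays no role.
\<close>

definition order_isomorphic :: "'a rel \<Rightarrow> 'b rel \<Rightarrow> bool"  (infix \<open>\<cong>\<^sub>o\<close> 50)
  where "r \<cong>\<^sub>o s \<longleftrightarrow> (\<exists>f. iso r s f)"

text \<open>
  The first coordinate is the dominant one. The library's \<open><*lex*>\<close> is meant for strict relations: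
  applied to a reflexive first component it would not compare second coordinates.
\<close>

definition lex_product :: "'a rel \<Rightarrow> 'b rel \<Rightarrow> ('a \<times> 'b) rel"
  where "lex_product A X =
    {((a, x), (b, y)). a \<in> Field A \<and> b \<in> Field A \<and> x \<in> Field X \<and> y \<in> Field X \<and>
       (a \<noteq> b \<and> (a, b) \<in> A \<or> a = b \<and> (x, y) \<in> X)}"

definition omega_power :: "'a rel \<Rightarrow> 'a stream rel"
  where "omega_power A =
    {(u, v). u \<in> streams (Field A) \<and> v \<in> streams (Field A) \<and>
       (u = v \<or> (\<exists>n. (\<forall>k<n. u !! k = v !! k) \<and> u !! n \<noteq> v !! n \<and> (u !! n, v !! n) \<in> A))}"

definition tail_equiv :: "'a set \<Rightarrow> 'a stream \<Rightarrow> 'a stream \<Rightarrow> bool"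
  where "tail_equiv C u v \<longleftrightarrow>
    (\<exists>r \<in> lists C. \<exists>s \<in> lists C. \<exists>u' \<in> streams C. u = r @- u' \<and> v = s @- u')"

definition replacement :: "'y rel \<Rightarrow> ('y \<Rightarrow> 'i rel) \<Rightarrow> ('y \<times> 'i) rel"
  where "replacement Y I =
    {((y, i), (z, j)). y \<in> Field Y \<and> z \<in> Field Y \<and> i \<in> Field (I y) \<and> j \<in> Field (I z) \<and>
       (y \<noteq> z \<and> (y, z) \<in> Y \<or> y = z \<and> (i, j) \<in> I y)}"

text \<open>
  The type \<open>'i\<close> cannot be quantified existentially. If an order \<open>X\<close> on \<open>'x\<close> is isomorphic to
  \<open>A\<^sup>\<omega>(I\<^sub>u)\<close>, every \<open>I\<^sub>u\<close> embeds into \<open>X\<close>, so families with \<open>'i = 'x\<close> represent all possible ones.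
\<close>

definition tail_invariant_family :: "'a rel \<Rightarrow> ('a stream \<Rightarrow> 'i rel) \<Rightarrow> bool"
  where "tail_invariant_family A I \<longleftrightarrow>
    (\<forall>u \<in> streams (Field A). Linear_order (I u)) \<and>
    (\<forall>u \<in> streams (Field A). \<forall>v \<in> streams (Field A). tail_equiv (Field A) u v \<longrightarrow> I u = I v)"

end

theory Submission
  imports Defs
begin

text \<open>
  An isomorphism \<open>X \<cong> AX\<close> reads off from each point of \<open>X\<close> a first letter in \<open>A\<close> and a
  remaining point of \<open>X\<close>; iterating it assigns to each point an itinerary in \<open>A\<^sup>\<omega>\<close>. Itineraries
  are weakly monotone, so \<open>X\<close> is \<open>A\<^sup>\<omega>\<close> with each \<open>u\<close> replaced by its fibre, and forgetting the
  first letter is an isomorphism from the fibre over \<open>au\<close> to the fibre over \<open>u\<close>. Conversely,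
  \<open>A (A\<^sup>\<omega>(I\<^sub>u)) \<cong> (A A\<^sup>\<omega>)(I\<^sub>u)\<close> by associativity of replacement, and prepending a letter is an
  isomorphism \<open>A A\<^sup>\<omega> \<cong> A\<^sup>\<omega>\<close> that respects the family when \<open>I\<close> is constant on tail-equivalence
  classes.
\<close>

section \<open>Order isomorphisms\<close>

lemma isoI:
  assumes "bij_betw f (Field r) (Field s)"
    and "\<And>x y. x \<in> Field r \<Longrightarrow> y \<in> Field r \<Longrightarrow> (x, y) \<in> r \<longleftrightarrow> (f x, f y) \<in> s"
  shows "iso r s f"
  using assms unfolding iso_iff2 by blast

lemma order_isomorphicI: "iso r s f \<Longrightarrow> r \<cong>\<^sub>o s"
  unfolding order_isomorphic_def by blast

lemma order_isomorphicE:
  assumes "r \<cong>\<^sub>o s"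
  obtains f where "iso r s f"
  using assms unfolding order_isomorphic_def by blast

lemma iso_inv_into:
  assumes "iso r s f"
  shows "iso s r (inv_into (Field r) f)"
proof (rule isoI)
  show "bij_betw (inv_into (Field r) f) (Field s) (Field r)"
    using assms by (auto simp: iso_iff2 intro: bij_betw_inv_into)
  fix x y assume "x \<in> Field s" "y \<in> Field s"
  then have "f (inv_into (Field r) f x) = x" "f (inv_into (Field r) f y) = y"
    using iso_Field[OF assms] by (simp_all add: f_inv_into_f)
  then show "(x, y) \<in> s \<longleftrightarrow> (inv_into (Field r) f x, inv_into (Field r) f y) \<in> r"
    using iso_backward[OF _ assms] iso_forward[OF _ assms] by metis
qed

lemma order_isomorphic_refl: "r \<cong>\<^sub>o r"
  by (rule order_isomorphicI) (rule id_iso)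

lemma order_isomorphic_sym [sym]: "r \<cong>\<^sub>o s \<Longrightarrow> s \<cong>\<^sub>o r"
  by (blast elim: order_isomorphicE intro: order_isomorphicI iso_inv_into)

lemma order_isomorphic_trans [trans]: "r \<cong>\<^sub>o s \<Longrightarrow> s \<cong>\<^sub>o t \<Longrightarrow> r \<cong>\<^sub>o t"
  by (blast elim: order_isomorphicE intro: order_isomorphicI comp_iso)

lemma compat_Field: "compat r s f \<Longrightarrow> x \<in> Field r \<Longrightarrow> f x \<in> Field s"
  unfolding compat_def Field_def by blast

lemma iso_compat: "iso r s f \<Longrightarrow> compat r s f"
  unfolding iso_def by (blast intro: embed_compat)

section \<open>Replacements\<close>

lemma replacement_iff:
  "((y, i), (z, j)) \<in> replacement Y I \<longleftrightarrow>
     y \<in> Field Y \<and> z \<in> Field Y \<and> i \<in> Field (I y) \<and> j \<in> Field (I z) \<and>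
     (y \<noteq> z \<and> (y, z) \<in> Y \<or> y = z \<and> (i, j) \<in> I y)"
  by (simp add: replacement_def)

lemma Field_replacement [simp]: "Field (replacement Y I) = (SIGMA y:Field Y. Field (I y))"
proof
  show "Field (replacement Y I) \<subseteq> (SIGMA y:Field Y. Field (I y))"
    unfolding replacement_def Field_def by auto
  show "(SIGMA y:Field Y. Field (I y)) \<subseteq> Field (replacement Y I)"
  proof clarify
    fix y i assume y: "y \<in> Field Y" and i: "i \<in> Field (I y)"
    then obtain j where "(i, j) \<in> I y \<or> (j, i) \<in> I y" unfolding Field_def by blast
    then have "((y, i), (y, j)) \<in> replacement Y I \<or> ((y, j), (y, i)) \<in> replacement Y I"
      using y by (auto simp: replacement_iff intro: FieldI1 FieldI2)
    then show "(y, i) \<in> Field (replacement Y I)"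
      by (blast intro: FieldI1 FieldI2)
  qed
qed

lemma Refl_replacement: "(\<And>y. y \<in> Field Y \<Longrightarrow> Refl (I y)) \<Longrightarrow> Refl (replacement Y I)"
  by (auto simp: refl_on_def replacement_iff)

lemma lex_product_eq_replacement: "lex_product A X = replacement A (\<lambda>_. X)"
  unfolding lex_product_def replacement_def by auto

lemma Field_lex_product [simp]: "Field (lex_product A X) = Field A \<times> Field X"
  by (simp add: lex_product_eq_replacement)

lemma Refl_lex_product: "Refl X \<Longrightarrow> Refl (lex_product A X)"
  unfolding lex_product_eq_replacement by (rule Refl_replacement)

lemma bij_betw_Sigma:
  assumes f: "bij_betw f A B" and g: "\<And>x. x \<in> A \<Longrightarrow> bij_betw (g x) (C x) (D (f x))"
  shows "bij_betw (\<lambda>(x, y). (f x, g x y)) (Sigma A C) (Sigma B D)"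
  unfolding bij_betw_def
proof
  show "inj_on (\<lambda>(x, y). (f x, g x y)) (Sigma A C)"
  proof (rule inj_onI, clarify)
    fix x y x' y' assume "x \<in> A" "y \<in> C x" "x' \<in> A" "y' \<in> C x'" "f x = f x'" "g x y = g x' y'"
    moreover from this have "x = x'"
      using f by (auto dest: bij_betw_imp_inj_on inj_onD)
    ultimately show "x = x' \<and> y = y'"
      using g by (auto dest: bij_betw_imp_inj_on inj_onD)
  qed
  have "(\<lambda>(x, y). (f x, g x y)) ` Sigma A C = (\<Union>x\<in>A. {f x} \<times> g x ` C x)"
    by auto
  also have "\<dots> = (\<Union>x\<in>A. {f x} \<times> D (f x))"
    using g by (simp add: bij_betw_def)
  also have "\<dots> = Sigma B D"
    using f by (auto simp: bij_betw_def)
  finally show "(\<lambda>(x, y). (f x, g x y)) ` Sigma A C = Sigma B D" .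
qed

lemma replacement_cong:
  assumes f: "iso Y Z f" and IJ: "\<And>y. y \<in> Field Y \<Longrightarrow> I y \<cong>\<^sub>o J (f y)"
  shows "replacement Y I \<cong>\<^sub>o replacement Z J"
proof -
  have "\<forall>y\<in>Field Y. \<exists>g. iso (I y) (J (f y)) g"
    using IJ unfolding order_isomorphic_def by blast
  then obtain g where g: "\<And>y. y \<in> Field Y \<Longrightarrow> iso (I y) (J (f y)) (g y)"
    by metis
  let ?h = "\<lambda>(y, i). (f y, g y i)"
  have "iso (replacement Y I) (replacement Z J) ?h"
  proof (rule isoI)
    show "bij_betw ?h (Field (replacement Y I)) (Field (replacement Z J))"
      using f g unfolding Field_replacement iso_iff2 by (intro bij_betw_Sigma) auto
    fix p q assume "p \<in> Field (replacement Y I)" "q \<in> Field (replacement Y I)"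
    then obtain y i z j where pq: "p = (y, i)" "q = (z, j)"
      and mem: "y \<in> Field Y" "z \<in> Field Y" "i \<in> Field (I y)" "j \<in> Field (I z)"
      by auto
    have "f y = f z \<longleftrightarrow> y = z"
      using f mem by (meson inj_on_eq_iff iso_imp_inj_on)
    moreover have "(y, z) \<in> Y \<longleftrightarrow> (f y, f z) \<in> Z"
      using f mem unfolding iso_iff2 by blast
    moreover have "(i, j) \<in> I y \<longleftrightarrow> (g y i, g y j) \<in> J (f y)" if "y = z"
      using g mem that unfolding iso_iff2 by blast
    moreover have "f y \<in> Field Z" "f z \<in> Field Z"
      "g y i \<in> Field (J (f y))" "g z j \<in> Field (J (f z))"
      using iso_Field[OF f] iso_Field[OF g] mem by blast+
    ultimately show "(p, q) \<in> replacement Y I \<longleftrightarrow> (?h p, ?h q) \<in> replacement Z J"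
      using mem by (auto simp: pq replacement_iff)
  qed
  then show ?thesis by (rule order_isomorphicI)
qed

lemma lex_product_cong:
  assumes "X \<cong>\<^sub>o Y"
  shows "lex_product A X \<cong>\<^sub>o lex_product A Y"
  unfolding lex_product_eq_replacement using id_iso assms by (rule replacement_cong)

lemma replacement_replacement:
  "replacement Y (\<lambda>y. replacement (J y) (I y))
   \<cong>\<^sub>o replacement (replacement Y J) (\<lambda>(y, j). I y j)"
    (is "?R \<cong>\<^sub>o ?S")
proof (rule order_isomorphicI, rule isoI)
  let ?f = "\<lambda>(y, j, i). ((y, j), i)"
  show "bij_betw ?f (Field ?R) (Field ?S)"
    by (rule bij_betw_byWitness[where f' = "\<lambda>((y, j), i). (y, j, i)"]) auto
  fix p q assume "p \<in> Field ?R" "q \<in> Field ?R"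
  then show "(p, q) \<in> ?R \<longleftrightarrow> (?f p, ?f q) \<in> ?S"
    by (auto simp: replacement_iff)
qed

lemma lex_product_replacement:
  "lex_product A (replacement Y I) \<cong>\<^sub>o replacement (lex_product A Y) (\<lambda>(_, y). I y)"
  unfolding lex_product_eq_replacement by (rule replacement_replacement)

section \<open>Powers\<close>

lemma Field_omega_power [simp]: "Field (omega_power A) = streams (Field A)"
  unfolding omega_power_def by (auto simp: Field_def)

lemma antisym_omega_power:
  assumes "antisym A"
  shows "antisym (omega_power A)"
proof (rule antisymI, rule ccontr)
  fix u v assume "(u, v) \<in> omega_power A" "(v, u) \<in> omega_power A" "u \<noteq> v"
  then obtain m n where m: "\<forall>k<m. u !! k = v !! k" "u !! m \<noteq> v !! m" "(u !! m, v !! m) \<in> A"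
    and n: "\<forall>k<n. v !! k = u !! k" "v !! n \<noteq> u !! n" "(v !! n, u !! n) \<in> A"
    unfolding omega_power_def by auto
  then have "m = n" by (metis linorder_neqE_nat)
  with m n assms show False by (auto dest: antisymD)
qed

lemma omega_power_SCons_iff:
  "(a ## u, b ## v) \<in> omega_power A \<longleftrightarrow> ((a, u), (b, v)) \<in> lex_product A (omega_power A)"
proof -
  have ex_nat: "(\<exists>n. P n) \<longleftrightarrow> P 0 \<or> (\<exists>n. P (Suc n))" for P
    by (metis nat.exhaust)
  have "(\<exists>n. (\<forall>k<n. (a ## u) !! k = (b ## v) !! k) \<and> (a ## u) !! n \<noteq> (b ## v) !! n \<and>
          ((a ## u) !! n, (b ## v) !! n) \<in> A) \<longleftrightarrow>
        (a \<noteq> b \<and> (a, b) \<in> A) \<or>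
        (a = b \<and> (\<exists>n. (\<forall>k<n. u !! k = v !! k) \<and> u !! n \<noteq> v !! n \<and> (u !! n, v !! n) \<in> A))"
    by (subst ex_nat) (auto simp: All_less_Suc2)
  then show ?thesis
    by (auto simp: lex_product_def) (auto simp: omega_power_def streams_Stream)
qed

lemma iso_SCons_omega_power:
  "iso (lex_product A (omega_power A)) (omega_power A) (\<lambda>(a, u). a ## u)"
proof (rule isoI)
  show "bij_betw (\<lambda>(a, u). a ## u)
      (Field (lex_product A (omega_power A))) (Field (omega_power A))"
    by (rule bij_betw_byWitness[where f' = "\<lambda>u. (shd u, stl u)"])
      (auto simp: streams_Stream streams_shd streams_stl)
qed (auto simp: omega_power_SCons_iff)

lemma tail_equiv_SCons:
  assumes "a \<in> C" and "u \<in> streams C"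
  shows "tail_equiv C (a ## u) u"
  unfolding tail_equiv_def using assms
  by (intro bexI[of _ "[a]"] bexI[of _ "[]"] bexI[of _ u]) auto

lemma tail_invariant_family_SCons:
  assumes "tail_invariant_family A I" and "a \<in> Field A" and "u \<in> streams (Field A)"
  shows "I (a ## u) = I u"
  using assms tail_equiv_SCons unfolding tail_invariant_family_def by (metis streams_Stream)

lemma lex_product_replacement_omega_power:
  assumes "tail_invariant_family A I"
  shows "lex_product A (replacement (omega_power A) I) \<cong>\<^sub>o replacement (omega_power A) I"
proof -
  note lex_product_replacement
  also have "replacement (lex_product A (omega_power A)) (\<lambda>(_, u). I u)
      \<cong>\<^sub>o replacement (omega_power A) I"
    using iso_SCons_omega_power
    by (rule replacement_cong)
      (auto simp: tail_invariant_family_SCons[OF assms] order_isomorphic_refl)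
  finally show ?thesis .
qed

lemma lex_product_absorbs_if_replacement_omega_power:
  assumes "tail_invariant_family A I" and X: "X \<cong>\<^sub>o replacement (omega_power A) I"
  shows "lex_product A X \<cong>\<^sub>o X"
proof -
  note lex_product_cong[OF X]
  also note lex_product_replacement_omega_power[OF assms(1)]
  also note X[symmetric]
  finally show ?thesis .
qed

section \<open>Fibres\<close>

definition fibre :: "'x rel \<Rightarrow> ('x \<Rightarrow> 'y) \<Rightarrow> 'y \<Rightarrow> 'x rel"
  where "fibre X p y = Restr X (p -` {y})"

lemma Field_fibre: "Refl X \<Longrightarrow> Field (fibre X p y) = {x \<in> Field X. p x = y}"
  unfolding fibre_def by (auto simp: Refl_Field_Restr)

lemma Linear_order_fibre: "Linear_order X \<Longrightarrow> Linear_order (fibre X p y)"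
  unfolding fibre_def by (rule Linear_order_Restr)

lemma fibre_cong:
  assumes X: "Refl X" and Z: "Refl Z" and h: "iso X Z h"
    and pq: "\<And>x. x \<in> Field X \<Longrightarrow> q (h x) = p x"
  shows "fibre X p y \<cong>\<^sub>o fibre Z q y"
proof (rule order_isomorphicI, rule isoI)
  show "bij_betw h (Field (fibre X p y)) (Field (fibre Z q y))"
    using h unfolding iso_iff2 Field_fibre[OF X] Field_fibre[OF Z]
    by (auto simp: pq intro: bij_betw_Collect)
  fix x x' assume "x \<in> Field (fibre X p y)" "x' \<in> Field (fibre X p y)"
  then show "(x, x') \<in> fibre X p y \<longleftrightarrow> (h x, h x') \<in> fibre Z q y"
    using h pq unfolding iso_iff2 Field_fibre[OF X] by (auto simp: fibre_def)
qed

lemma fibre_lex_product_SCons: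
  assumes X: "Refl X" and a: "a \<in> Field A"
  shows "fibre (lex_product A X) (\<lambda>(a, x). a ## p x) (a ## u) \<cong>\<^sub>o fibre X p u"
    (is "?F \<cong>\<^sub>o _")
proof (rule order_isomorphicI, rule isoI)
  have Field_F: "Field ?F = {a} \<times> Field (fibre X p u)"
    using a by (auto simp: Field_fibre[OF X] Field_fibre[OF Refl_lex_product[OF X]])
  then show "bij_betw snd (Field ?F) (Field (fibre X p u))"
    by (simp add: bij_betw_def inj_on_def)
  fix v w assume "v \<in> Field ?F" "w \<in> Field ?F"
  then show "(v, w) \<in> ?F \<longleftrightarrow> (snd v, snd w) \<in> fibre X p u"
    using a X unfolding Field_F by (auto simp: fibre_def lex_product_def Refl_Field_Restr)
qed

lemma order_isomorphic_replacement_fibres: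
  assumes X: "Linear_order X" and Y: "antisym Y" and p: "compat X Y p"
  shows "X \<cong>\<^sub>o replacement Y (fibre X p)"
proof (rule order_isomorphicI, rule isoI)
  have Refl: "Refl X" and Total: "Total X"
    using X by (auto simp: order_on_defs)
  show "bij_betw (\<lambda>x. (p x, x)) (Field X) (Field (replacement Y (fibre X p)))"
    by (rule bij_betw_byWitness[where f' = snd])
      (auto simp: Field_fibre[OF Refl] compat_Field[OF p])
  fix x x' assume mem: "x \<in> Field X" "x' \<in> Field X"
  have "(x, x') \<in> X" if less: "p x \<noteq> p x'" "(p x, p x') \<in> Y"
  proof (rule ccontr)
    assume "(x, x') \<notin> X"
    with less mem Total have "(x', x) \<in> X" unfolding total_on_def by metis
    with p less Y show False by (auto simp: compat_def dest: antisymD)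
  qed
  moreover have "(p x, p x') \<in> Y" if "(x, x') \<in> X"
    using p that unfolding compat_def by blast
  ultimately show "(x, x') \<in> X \<longleftrightarrow> ((p x, x), (p x', x')) \<in> replacement Y (fibre X p)"
    using mem compat_Field[OF p]
    by (auto simp: replacement_iff Field_fibre[OF Refl]) (auto simp: fibre_def)
qed

section \<open>Itineraries\<close>

primcorec itinerary :: "('x \<Rightarrow> 'a \<times> 'x) \<Rightarrow> 'x \<Rightarrow> 'a stream"
  where "itinerary h x = (case h x of (a, x') \<Rightarrow> a ## itinerary h x')"

lemma itinerary_eq_SCons: "h x = (a, x') \<Longrightarrow> itinerary h x = a ## itinerary h x'"
  by (subst itinerary.code) simp

lemma itinerary_in_streams:
  assumes "\<And>x. x \<in> S \<Longrightarrow> h x \<in> C \<times> S" and "x \<in> S"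
  shows "itinerary h x \<in> streams C"
  using assms(2)
proof (coinduction arbitrary: x)
  case (streams x)
  obtain a x' where "h x = (a, x')" by fastforce
  with assms(1)[OF streams] show ?case
    by (auto intro: itinerary_eq_SCons)
qed

lemma compat_itinerary_in_streams:
  assumes "compat X (lex_product A X) h" and "x \<in> Field X"
  shows "itinerary h x \<in> streams (Field A)"
  using compat_Field[OF assms(1)] assms(2) by (intro itinerary_in_streams[of "Field X"]) auto

lemma omega_power_itinerary_if_snth_neq:
  assumes h: "compat X (lex_product A X) h"
    and "(x, y) \<in> X" and "itinerary h x !! n \<noteq> itinerary h y !! n"
  shows "(itinerary h x, itinerary h y) \<in> omega_power A"
  using assms(2,3)
proof (induction n arbitrary: x y rule: less_induct)
  case (less n x y)
  obtain a x' b y' where hxy: "h x = (a, x')" "h y = (b, y')"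
    by (meson surj_pair)
  have itinerary: "itinerary h x = a ## itinerary h x'" "itinerary h y = b ## itinerary h y'"
    using hxy by (simp_all add: itinerary_eq_SCons)
  have lex: "((a, x'), (b, y')) \<in> lex_product A X"
    using h less.prems(1) unfolding compat_def hxy[symmetric] by blast
  have "(itinerary h x', itinerary h y') \<in> omega_power A" if eq: "a = b"
  proof -
    obtain m where "n = Suc m" "itinerary h x' !! m \<noteq> itinerary h y' !! m"
      using less.prems(2) eq unfolding itinerary by (cases n) simp_all
    moreover have "(x', y') \<in> X"
      using lex eq by (simp add: lex_product_def)
    ultimately show ?thesis using less.IH by blast
  qed
  with lex have "((a, itinerary h x'), (b, itinerary h y')) \<in> lex_product A (omega_power A)"
    using compat_itinerary_in_streams[OF h] by (auto simp: lex_product_def)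
  then show ?case
    unfolding itinerary omega_power_SCons_iff .
qed

lemma compat_itinerary:
  assumes h: "compat X (lex_product A X) h"
  shows "compat X (omega_power A) (itinerary h)"
  unfolding compat_def
proof (intro allI impI)
  fix x y assume xy: "(x, y) \<in> X"
  show "(itinerary h x, itinerary h y) \<in> omega_power A"
  proof (cases "itinerary h x = itinerary h y")
    case True
    then show ?thesis
      using compat_itinerary_in_streams[OF h FieldI1[OF xy]] by (simp add: omega_power_def)
  next
    case False
    then obtain n where "itinerary h x !! n \<noteq> itinerary h y !! n"
      using smap_alt[of id "itinerary h x"] by (auto simp: stream.map_id)
    with h xy show ?thesis by (rule omega_power_itinerary_if_snth_neq)
  qed
qed

lemma fibre_itinerary_SCons:
  assumes X: "Refl X" and h: "iso X (lex_product A X) h" and a: "a \<in> Field A"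
  shows "fibre X (itinerary h) (a ## u) \<cong>\<^sub>o fibre X (itinerary h) u"
proof -
  have "fibre X (itinerary h) (a ## u)
      \<cong>\<^sub>o fibre (lex_product A X) (\<lambda>(a, x). a ## itinerary h x) (a ## u)"
    using X Refl_lex_product[OF X] h
    by (rule fibre_cong) (simp add: itinerary_eq_SCons split: prod.split)
  also note fibre_lex_product_SCons[OF X a]
  finally show ?thesis .
qed

section \<open>Tail-invariant families\<close>

lemma order_isomorphic_tail_equiv:
  assumes SCons: "\<And>a u. a \<in> C \<Longrightarrow> u \<in> streams C \<Longrightarrow> J (a ## u) \<cong>\<^sub>o J u"
    and "tail_equiv C u v"
  shows "J u \<cong>\<^sub>o J v"
proof -
  have shift: "J (r @- w) \<cong>\<^sub>o J w" if "r \<in> lists C" "w \<in> streams C" for r w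
    using that(1)
  proof induction
    case Nil
    show ?case by (simp add: order_isomorphic_refl)
  next
    case (Cons a r)
    have "J (a ## (r @- w)) \<cong>\<^sub>o J (r @- w)"
      using Cons that(2) by (intro SCons shift_streams)
    also note Cons.IH
    finally show ?case by simp
  qed
  obtain r s w where r: "r \<in> lists C" and s: "s \<in> lists C" and w: "w \<in> streams C"
    and uv: "u = r @- w" "v = s @- w"
    using assms(2) unfolding tail_equiv_def by blast
  note shift[OF r w]
  also note shift[OF s w, symmetric]
  finally show ?thesis unfolding uv .
qed

text \<open>
  The orders \<open>J u\<close> are only isomorphic along a class, whereas a tail-invariant family must be
  literally constant there; so every \<open>J u\<close> is replaced by a chosen isomorphic member of \<open>J\<close>.
\<close>

lemma obtain_tail_invariant_family:
  fixes J :: "'a stream \<Rightarrow> 'x rel"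
  assumes linear: "\<And>u. u \<in> streams (Field A) \<Longrightarrow> Linear_order (J u)"
    and SCons: "\<And>a u. a \<in> Field A \<Longrightarrow> u \<in> streams (Field A) \<Longrightarrow> J (a ## u) \<cong>\<^sub>o J u"
  obtains I :: "'a stream \<Rightarrow> 'x rel"
  where "tail_invariant_family A I" and "\<And>u. u \<in> streams (Field A) \<Longrightarrow> J u \<cong>\<^sub>o I u"
proof -
  define rep where "rep u = (SOME v. v \<in> streams (Field A) \<and> J u \<cong>\<^sub>o J v)" for u
  have rep: "rep u \<in> streams (Field A) \<and> J u \<cong>\<^sub>o J (rep u)" if "u \<in> streams (Field A)" for u
    unfolding rep_def by (rule someI[of _ u]) (simp add: that order_isomorphic_refl)
  have "rep u = rep v" if "tail_equiv (Field A) u v" for u v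
  proof -
    have "J u \<cong>\<^sub>o J v" using SCons that by (rule order_isomorphic_tail_equiv[of "Field A" J])
    then have "J u \<cong>\<^sub>o J w \<longleftrightarrow> J v \<cong>\<^sub>o J w" for w
      by (meson order_isomorphic_trans order_isomorphic_sym)
    then show ?thesis by (simp add: rep_def)
  qed
  with rep linear have "tail_invariant_family A (\<lambda>u. J (rep u))"
    by (auto simp: tail_invariant_family_def)
  then show ?thesis using rep by (intro that[of "\<lambda>u. J (rep u)"]) simp_all
qed

lemma replacement_omega_power_if_lex_product_absorbs:
  fixes A :: "'a rel" and X :: "'x rel"
  assumes A: "antisym A" and X: "Linear_order X" and "lex_product A X \<cong>\<^sub>o X"
  obtains I :: "'a stream \<Rightarrow> 'x rel"
  where "tail_invariant_family A I" and "X \<cong>\<^sub>o replacement (omega_power A) I"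
proof -
  have Refl: "Refl X" using X by (simp add: order_on_defs)
  obtain h where h: "iso X (lex_product A X) h"
    using assms(3)[symmetric] by (rule order_isomorphicE)
  obtain I :: "'a stream \<Rightarrow> 'x rel" where I: "tail_invariant_family A I"
    and fibre: "\<And>u. u \<in> streams (Field A) \<Longrightarrow> fibre X (itinerary h) u \<cong>\<^sub>o I u"
    by (rule obtain_tail_invariant_family[of A "fibre X (itinerary h)"])
      (blast intro: Linear_order_fibre[OF X] fibre_itinerary_SCons[OF Refl h])+
  have "X \<cong>\<^sub>o replacement (omega_power A) (fibre X (itinerary h))"
    using X antisym_omega_power[OF A] compat_itinerary[OF iso_compat[OF h]]
    by (rule order_isomorphic_replacement_fibres)
  also have "\<dots> \<cong>\<^sub>o replacement (omega_power A) I"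
    using id_iso by (rule replacement_cong) (simp add: fibre)
  finally show ?thesis using I by (rule that[rotated])
qed

theorem theorem3p5:
  fixes A :: "'a rel" and X :: "'x rel"
  assumes "Linear_order A" and "Linear_order X"
  shows "(lex_product A X \<cong>\<^sub>o X \<longleftrightarrow>
           (\<exists>I :: 'a stream \<Rightarrow> 'x rel.
              tail_invariant_family A I \<and> X \<cong>\<^sub>o replacement (omega_power A) I)) \<and>
         (\<forall>I :: 'a stream \<Rightarrow> 'i rel.
              tail_invariant_family A I \<and> X \<cong>\<^sub>o replacement (omega_power A) I \<longrightarrow>
              lex_product A X \<cong>\<^sub>o X)"
proof -
  have "antisym A"
    using assms(1) by (simp add: order_on_defs)
  then have "\<exists>I :: 'a stream \<Rightarrow> 'x rel.
      tail_invariant_family A I \<and> X \<cong>\<^sub>o replacement (omega_power A) I"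
    if "lex_product A X \<cong>\<^sub>o X"
    using assms(2) that by (rule replacement_omega_power_if_lex_product_absorbs) blast
  then show ?thesis
    by (blast intro: lex_product_absorbs_if_replacement_omega_power)
qed

end
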